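(* Let $a(z)$ be a rational function, let $P(z,w)$ be a polynomial in $w$ having rational coefficients in $z$, and let $Q(z,w)$ be a polynomial in $w$ with rational coefficients in $z$, of degree at least one in $w$, whose roots (in $w$) are nonzero rational functions of $z$ and are not roots of $P(z,w)$. Then the equation $$w(z+1)-w(z-1)+a(z)\frac{w'(z)}{w(z)}=\frac{P(z,w(z))}{Q(z,w(z))}$$ has no transcendental entire solutions $w(z)$ with $\sigma_2(w)<1$.
   Context: All rational functions of $z$ are over $\mathbb{C}$ and may be identically zero unless stated otherwise. The hyper-order of a meromorphic function $w$ in the complex plane is $\sigma_2(w)=\limsup_{r\to\infty}\frac{\log\log T(r,w)}{\log r}$, where $T(r,w)$ is the Nevanlinna characteristic. A solution of the equation is a function satisfying it identically as an identity of meromorphic functions. *)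

theory Defs
  imports
    "HOL-Complex_Analysis.Complex_Analysis"
    "HOL-Computational_Algebra.Computational_Algebra"
    "HOL-Computational_Algebra.Field_as_Ring"
    "HOL-Algebra.Algebraic_Closure_Type"
begin

text \<open>The field \<open>\<complex>(z)\<close>; polynomials in \<open>w\<close> with rational coefficients are elements of
  \<open>ratfun poly\<close>.\<close>

type_synonym ratfun = "complex poly fract"

text \<open>The value at a point, computed from the representation in lowest terms. At the (finitely
  many) poles the value is \<open>0\<close> by the convention \<open>x / 0 = 0\<close>; below, identities
  between meromorphic functions are only ever required off a closed discrete set of points.\<close>

definition rat_eval :: "ratfun \<Rightarrow> complex \<Rightarrow> complex" where
  "rat_eval r z = poly (fst (quot_of_fract r)) z / poly (snd (quot_of_fract r)) z"

text \<open>\<open>P(z, w)\<close> for \<open>P\<close> in \<open>\<complex>(z)[w]\<close>.\<close>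

definition poly_eval :: "ratfun poly \<Rightarrow> complex \<Rightarrow> complex \<Rightarrow> complex" where
  "poly_eval P z w = poly (map_poly (\<lambda>c. rat_eval c z) P) w"

text \<open>A meromorphic function in the plane is transcendental if it is not rational.\<close>

definition transcendental :: "(complex \<Rightarrow> complex) \<Rightarrow> bool" where
  "transcendental f \<longleftrightarrow> f meromorphic_on UNIV \<and> \<not> (\<exists>r. \<forall>\<^sub>\<approx>z. f z = rat_eval r z)"

subsection \<open>The Nevanlinna characteristic and the hyper-order\<close>

text \<open>The number of poles of \<open>f\<close> in the closed disc \<open>|z| \<le> t\<close>, counted with
  multiplicity (at a pole, \<open>zorder\<close> is minus the multiplicity).\<close>

definition pole_count :: "(complex \<Rightarrow> complex) \<Rightarrow> real \<Rightarrow> nat" where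
  "pole_count f t = (\<Sum>z | is_pole f z \<and> cmod z \<le> t. nat (- zorder f z))"

definition counting_fun :: "(complex \<Rightarrow> complex) \<Rightarrow> real \<Rightarrow> real" where
  "counting_fun f r =
     integral {0..r} (\<lambda>t. (real (pole_count f t) - real (pole_count f 0)) / t)
     + real (pole_count f 0) * ln r"

definition log_plus :: "real \<Rightarrow> real" where
  "log_plus x = (if x \<le> 1 then 0 else ln x)"

definition proximity_fun :: "(complex \<Rightarrow> complex) \<Rightarrow> real \<Rightarrow> real" where
  "proximity_fun f r =
     integral {0..2 * pi} (\<lambda>\<theta>. log_plus (cmod (f (of_real r * cis \<theta>)))) / (2 * pi)"

definition nevanlinna_T :: "(complex \<Rightarrow> complex) \<Rightarrow> real \<Rightarrow> real" where
  "nevanlinna_T f r = proximity_fun f r + counting_fun f r"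

text \<open>Meaningful for nonconstant \<open>f\<close>: then \<open>nevanlinna_T f r\<close> tends to infinity, so
  that for large \<open>r\<close> the iterated logarithm is not affected by the totalisation of
  \<open>ln\<close>.\<close>

definition hyper_order :: "(complex \<Rightarrow> complex) \<Rightarrow> ereal" where
  "hyper_order f = Limsup at_top (\<lambda>r::real. ereal (ln (ln (nevanlinna_T f r)) / ln r))"

subsection \<open>The equation\<close>

text \<open>An identity of meromorphic functions: off a closed discrete set of points all denominators
  are nonzero and the two sides agree. In particular neither \<open>w\<close> nor \<open>Q(z, w(z))\<close>
  vanishes identically.\<close>

definition is_solution ::
  "ratfun \<Rightarrow> ratfun poly \<Rightarrow> ratfun poly \<Rightarrow> (complex \<Rightarrow> complex) \<Rightarrow> bool" where
  "is_solution a P Q w \<longleftrightarrow>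
     w meromorphic_on UNIV \<and>
     (\<forall>\<^sub>\<approx>z. w z \<noteq> 0 \<and> poly_eval Q z (w z) \<noteq> 0 \<and>
        w (z + 1) - w (z - 1) + rat_eval a z * (deriv w z / w z)
          = poly_eval P z (w z) / poly_eval Q z (w z))"

end

(* Let b be a root of Q. Multiplied out, the equation reads
     Q(z,w) (w (w(z+1) - w(z-1)) + a w') = w P(z,w),
   so w = b cannot happen at a point far out, where b P(z,b) is nonzero. Hence w = b + R e^g with R
   rational and g entire, and hyper-order < 1 makes A(r) = max {-Re g(z) : |z| <= r}
   subexponential. A(r+2) <= 7/6 A(r) then holds for arbitrarily large r; if -Re g attains A(r)
   at z0, Harnack's inequality gives Re g <= 0 on the unit disc about z0. There w is bounded by a power
   of |z0|, hence so are w(z0+1), w(z0-1) and w'(z0), while w(z0) - b(z0) and with it Q(z0,w(z0)) are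
   exponentially small, since A(r) grows at least linearly. But |w P(z,w)| is at z0 at least a
   negative power of |z0|. *)

theory Submission
  imports Defs "HOL-Real_Asymp.Real_Asymp"
begin

subsection \<open>Harnack's inequality and the Schwarz integral formula\<close>

text \<open>The obstacle is the shift. That w - b is tiny at z0 does not stop exp g from being huge
  at z0 + 1 or z0 - 1, where it could balance the equation: for g(z) = exp(i pi z), which gives w
  hyper-order 1, one has g(z + 1) = - g(z). Hence the search for a point at which -Re g is large and
  around which Re g <= 0 on a whole disc of radius 1; this disc contains both shifted points and the
  circle for Cauchy's estimate of w'(z0). An A that grew by a fixed factor over each step of length
  2 would be exponential, and this is what hyper-order < 1 excludes. The characteristic bounds only
  means of log+ |w| over circles, hence means of the positive part of Re g, whereas A measures the
  negative part. The mean value property ties the two together, since the mean of Re g is Re g(0),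
  and the Schwarz formula then passes from means to a pointwise bound of |g|. Linear growth of A
  needs that g is nonconstant, which transcendence of w guarantees; it makes exp(Re g(z0)) smaller
  than any given negative power of |z0|.\<close>

lemma
  fixes f :: "complex \<Rightarrow> complex"
  assumes L: "L > 0" and hol: "f holomorphic_on ball z0 L"
    and pos: "\<And>z. z \<in> ball z0 L \<Longrightarrow> Re (f z) > 0"
  shows Harnack_Re_upper:
      "z \<in> ball z0 L \<Longrightarrow> (L - dist z z0) * Re (f z) \<le> (L + dist z z0) * Re (f z0)"
    and norm_deriv_le_Re: "norm (deriv f z0) \<le> 2 * Re (f z0) / L"
proof -
  define c where "c = f z0"
  have c: "Re c > 0"
    using pos[of z0] L by (simp add: c_def)
  \<comment> \<open>A Cayley transform takes the right half-plane to the unit disc and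
    \<open>c\<close> to 0. Schwarz's lemma for \<open>\<phi>\<close> yields both claims: its bound
    on values gives Harnack's inequality, its bound on the derivative at 0 gives the other.\<close>
  define \<phi> where "\<phi> = (\<lambda>x. (f (z0 + of_real L * x) - c) / (f (z0 + of_real L * x) + cnj c))"
  have in_ball: "z0 + of_real L * x \<in> ball z0 L" if "norm x < 1" for x :: complex
    using that L by (simp add: dist_norm norm_mult)
  have den: "f (z0 + of_real L * x) + cnj c \<noteq> 0" if "norm x < 1" for x
  proof
    assume "f (z0 + of_real L * x) + cnj c = 0"
    hence "Re (f (z0 + of_real L * x)) + Re c = 0"
      by (simp add: complex_eq_iff)
    thus False
      using pos[OF in_ball[OF that]] c by linarith
  qed
  have \<phi>0: "\<phi> 0 = 0"
    by (simp add: \<phi>_def c_def)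
  have holc: "(\<lambda>x. f (z0 + of_real L * x)) holomorphic_on ball 0 1"
  proof -
    have "f \<circ> (\<lambda>x. z0 + of_real L * x) holomorphic_on ball 0 1"
      by (rule holomorphic_on_compose_gen[OF _ hol]) (use in_ball in \<open>auto intro!: holomorphic_intros\<close>)
    thus ?thesis by (simp add: o_def)
  qed
  have hol\<phi>: "\<phi> holomorphic_on ball 0 1"
    unfolding \<phi>_def using den by (intro holomorphic_intros holc) auto
  have sq: "(norm (a + cnj c))\<^sup>2 - (norm (a - c))\<^sup>2 = 4 * Re a * Re c" for a
    unfolding cmod_power2 by (simp add: power2_eq_square algebra_simps)
  have \<phi>1: "norm (\<phi> x) < 1" if "norm x < 1" for x
  proof -
    define a where "a = f (z0 + of_real L * x)"
    have "(norm (a - c))\<^sup>2 < (norm (a + cnj c))\<^sup>2"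
      using sq[of a] mult_pos_pos[OF pos[OF in_ball[OF that]] c] unfolding a_def by linarith
    hence "norm (a - c) < norm (a + cnj c)"
      by (rule power_less_imp_less_base) simp
    thus ?thesis
      by (auto simp: \<phi>_def a_def norm_divide divide_simps split: if_splits)
  qed
  have S1: "norm (\<phi> x) \<le> norm x" if "norm x < 1" for x
    by (rule Schwarz_Lemma(1)[OF hol\<phi> \<phi>0 \<phi>1 that])
  have S2: "norm (deriv \<phi> 0) \<le> 1"
    by (rule Schwarz_Lemma(2)[OF hol\<phi> \<phi>0 \<phi>1, of 0]) auto
  show "(L - dist z z0) * Re (f z) \<le> (L + dist z z0) * Re (f z0)" if z: "z \<in> ball z0 L"
  proof -
    define x where "x = (z - z0) / of_real L"
    have nx: "norm x = dist z z0 / L"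
      using L by (simp add: x_def norm_divide dist_norm)
    have nx1: "norm x < 1"
      using z L by (simp add: nx dist_commute)
    have zx: "z0 + of_real L * x = z"
      using L by (simp add: x_def)
    have "norm (f z - c) \<le> norm x * norm (f z + cnj c)"
      using S1[OF nx1] den[OF nx1] by (simp add: \<phi>_def zx norm_divide divide_simps)
    hence "(norm (f z - c))\<^sup>2 \<le> (norm x)\<^sup>2 * (norm (f z + cnj c))\<^sup>2"
      unfolding power_mult_distrib[symmetric] by (rule power_mono) simp
    hence "(Re (f z) - Re c)\<^sup>2 + (Im (f z) - Im c)\<^sup>2 \<le>
        (norm x)\<^sup>2 * (Re (f z) + Re c)\<^sup>2 + (norm x)\<^sup>2 * (Im (f z) - Im c)\<^sup>2"
      unfolding cmod_power2 distrib_left by simp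
    moreover have "(norm x)\<^sup>2 * (Im (f z) - Im c)\<^sup>2 \<le> 1 * (Im (f z) - Im c)\<^sup>2"
      using nx1 by (intro mult_right_mono) (auto simp: power_le_one)
    ultimately have "(Re (f z) - Re c)\<^sup>2 \<le> (norm x * (Re (f z) + Re c))\<^sup>2"
      unfolding power_mult_distrib by linarith
    moreover have "0 \<le> norm x * (Re (f z) + Re c)"
      using pos[OF z] c by (intro mult_nonneg_nonneg) auto
    ultimately have "Re (f z) - Re c \<le> norm x * (Re (f z) + Re c)"
      by (rule power2_le_imp_le)
    hence "L * (Re (f z) - Re c) \<le> L * (norm x * (Re (f z) + Re c))"
      using L by (intro mult_left_mono) auto
    also have "\<dots> = dist z z0 * (Re (f z) + Re c)"
      using L by (simp add: nx)
    finally show ?thesis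
      unfolding c_def left_diff_distrib right_diff_distrib distrib_left distrib_right by linarith
  qed
  \<comment> \<open>By the quotient rule \<open>\<phi>\<close> has derivative L f'(z0) / (2 Re c) at
    0, so \<open>S2\<close> is the second claim.\<close>
  have "f field_differentiable at z0"
    using hol L by (meson at_within_open centre_in_ball holomorphic_onD holomorphic_on_imp_differentiable_at open_ball)
  hence d: "(f has_field_derivative deriv f z0) (at (z0 + of_real L * 0))"
    using field_differentiable_derivI by simp
  have "((\<lambda>x. f (z0 + of_real L * x)) has_field_derivative deriv f z0 * of_real L) (at 0)"
    by (rule DERIV_chain2[where f = f and g = "\<lambda>x. z0 + of_real L * x", OF d]) (auto intro!: derivative_eq_intros)
  note D = DERIV_divide[OF DERIV_diff[OF this DERIV_const[of c]] DERIV_add[OF this DERIV_const[of "cnj c"]]]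
  have cc: "c + cnj c \<noteq> 0"
    using den[of 0] by (simp add: c_def)
  have "(\<phi> has_field_derivative (deriv f z0 * of_real L) * (c + cnj c) / ((c + cnj c) * (c + cnj c))) (at 0)"
    unfolding \<phi>_def using D den[of 0] by (simp add: c_def)
  hence "(\<phi> has_field_derivative of_real L * deriv f z0 / (c + cnj c)) (at 0)"
    using cc by (simp add: mult.commute)
  hence "norm (of_real L * deriv f z0 / (c + cnj c)) \<le> 1"
    using S2 by (metis DERIV_imp_deriv)
  moreover have "c + cnj c = of_real (2 * Re c)"
    by (simp add: complex_eq_iff)
  ultimately show "norm (deriv f z0) \<le> 2 * Re (f z0) / L"
    using L c by (simp add: norm_divide norm_mult c_def divide_simps mult.commute)
qed

lemma has_integral_Cauchy_circle:
  assumes "f holomorphic_on cball 0 r" "r > 0" "norm z < r"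
  shows "((\<lambda>t. f (of_real r * cis t) * (of_real r * cis t) / (of_real r * cis t - z))
           has_integral 2 * of_real pi * f z) {0..2*pi}"
proof -
  have "((\<lambda>u. f u / (u - z)) has_contour_integral 2 * of_real pi * \<i> * f z) (circlepath 0 r)"
    using assms by (intro Cauchy_integral_circlepath_simple) auto
  hence "((\<lambda>t. f (of_real r * cis t) / (of_real r * cis t - z) * of_real r * \<i> * cis t)
      has_integral 2 * of_real pi * \<i> * f z) {0..2*pi}"
    unfolding circlepath_def by (subst (asm) has_contour_integral_part_circlepath_iff) auto
  from has_integral_mult_right[OF this, of "-\<i>"] show ?thesis
    by (simp add: mult_ac)
qed

text \<open>Only a mean of Re g over the circle will be available, not its maximum, so the
  Borel-Caratheodory bound is taken in integral form. For \<open>norm z <= r / 2\<close> the factor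
  r / |\<zeta> - z| of the Schwarz kernel is at most 2; with the 2 of \<open>2 * Re g\<close> and
  the 2 pi of Cauchy's formula this gives \<open>2 / pi\<close>.\<close>

lemma norm_entire_le_integral_abs_Re:
  assumes hol: "g holomorphic_on UNIV" and r: "r > 0" and z: "norm z \<le> r / 2"
  shows "norm (g z) \<le> norm (g 0) + 2 / pi * integral {0..2*pi} (\<lambda>t. \<bar>Re (g (of_real r * cis t))\<bar>)"
proof -
  define \<zeta> where "\<zeta> = (\<lambda>t. of_real r * cis t)"
  have zr: "norm z < r"
    using z r by auto
  have n\<zeta>: "norm (\<zeta> t) = r" for t
    using r by (simp add: \<zeta>_def norm_mult)
  have \<zeta>z: "\<zeta> t - z \<noteq> 0" for t
    using n\<zeta>[of t] zr by auto
  have \<zeta>0: "\<zeta> t \<noteq> 0" for t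
    using n\<zeta>[of t] r by auto
  have \<zeta>\<zeta>: "\<zeta> t * cnj (\<zeta> t) = of_real (r^2)" for t
    by (simp add: complex_norm_square[symmetric] n\<zeta>)
  have cont: "continuous_on {0..2*pi} (\<lambda>t. g (\<zeta> t))"
    unfolding \<zeta>_def
    by (intro continuous_on_compose2[OF holomorphic_on_imp_continuous_on[OF hol]] continuous_intros) auto
  have i1: "((\<lambda>t. g (\<zeta> t) * \<zeta> t / (\<zeta> t - z)) has_integral 2 * of_real pi * g z) {0..2*pi}"
    unfolding \<zeta>_def using zr r by (intro has_integral_Cauchy_circle holomorphic_on_subset[OF hol]) auto
  \<comment> \<open>The conjugate of Cauchy's formula at 0 for \<open>k\<close> has the same kernel as Cauchy's formula at \<open>z\<close>
    for \<open>g\<close>; adding the two leaves only \<open>Re g\<close> under the integral.\<close>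
  define k where "k = (\<lambda>u. g u * of_real (r^2) / (of_real (r^2) - cnj z * u))"
  have kden: "of_real (r^2) - cnj z * u \<noteq> 0" if "norm u \<le> r" for u
  proof
    assume "of_real (r^2) - cnj z * u = 0"
    hence "norm (cnj z * u) = r^2"
      by (metis eq_iff_diff_eq_0 norm_of_real abs_power2)
    moreover have "norm (cnj z * u) \<le> norm z * r"
      using that by (simp add: norm_mult mult_left_mono)
    moreover have "norm z * r < r^2"
      using zr r by (simp add: power2_eq_square)
    ultimately show False by simp
  qed
  have "k holomorphic_on cball 0 r"
    unfolding k_def using kden by (intro holomorphic_intros holomorphic_on_subset[OF hol]) auto
  from has_integral_Cauchy_circle[OF this r, of 0] r
  have "((\<lambda>t. k (\<zeta> t)) has_integral 2 * of_real pi * g 0) {0..2*pi}"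
    using \<zeta>0 by (simp add: k_def \<zeta>_def)
  hence "((\<lambda>t. cnj (k (\<zeta> t))) has_integral cnj (2 * of_real pi * g 0)) {0..2*pi}"
    using has_integral_cnj[of "\<lambda>t. k (\<zeta> t)" "2 * of_real pi * g 0"] unfolding o_def by blast
  moreover have "cnj (k (\<zeta> t)) = cnj (g (\<zeta> t)) * \<zeta> t / (\<zeta> t - z)" for t
  proof -
    have "cnj (k (\<zeta> t)) = cnj (g (\<zeta> t)) * (\<zeta> t * cnj (\<zeta> t)) / (\<zeta> t * cnj (\<zeta> t) - z * cnj (\<zeta> t))"
      unfolding \<zeta>\<zeta> by (simp add: k_def)
    also have "\<dots> = (cnj (\<zeta> t) * (cnj (g (\<zeta> t)) * \<zeta> t)) / (cnj (\<zeta> t) * (\<zeta> t - z))"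
      by (simp add: algebra_simps)
    finally show ?thesis using \<zeta>0 by simp
  qed
  ultimately have i2: "((\<lambda>t. cnj (g (\<zeta> t)) * \<zeta> t / (\<zeta> t - z)) has_integral
      2 * of_real pi * cnj (g 0)) {0..2*pi}"
    by simp
  have "((\<lambda>t. g (\<zeta> t) * \<zeta> t / (\<zeta> t - z) + cnj (g (\<zeta> t)) * \<zeta> t / (\<zeta> t - z)) has_integral
      2 * of_real pi * g z + 2 * of_real pi * cnj (g 0)) {0..2*pi}"
    by (rule has_integral_add[OF i1 i2])
  moreover have "g (\<zeta> t) * \<zeta> t / (\<zeta> t - z) + cnj (g (\<zeta> t)) * \<zeta> t / (\<zeta> t - z)
      = of_real (2 * Re (g (\<zeta> t))) * \<zeta> t / (\<zeta> t - z)" for t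
    by (simp only: add_divide_distrib[symmetric] distrib_right[symmetric] complex_add_cnj)
  ultimately have i3: "((\<lambda>t. of_real (2 * Re (g (\<zeta> t))) * \<zeta> t / (\<zeta> t - z)) has_integral
      2 * of_real pi * (g z + cnj (g 0))) {0..2*pi}"
    by (simp add: distrib_left)
  have int: "(\<lambda>t. 4 * \<bar>Re (g (\<zeta> t))\<bar>) integrable_on {0..2*pi}"
    by (intro integrable_continuous_interval continuous_intros cont)
  have "norm (integral {0..2*pi} (\<lambda>t. of_real (2 * Re (g (\<zeta> t))) * \<zeta> t / (\<zeta> t - z)))
      \<le> integral {0..2*pi} (\<lambda>t. 4 * \<bar>Re (g (\<zeta> t))\<bar>)"
  proof (rule integral_norm_bound_integral)
    fix t
    have "r / 2 \<le> norm (\<zeta> t - z)"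
      using norm_triangle_ineq2[of "\<zeta> t" z] z n\<zeta>[of t] by auto
    hence "r / norm (\<zeta> t - z) \<le> 2"
      using r by (simp add: divide_simps)
    hence "2 * \<bar>Re (g (\<zeta> t))\<bar> * (r / norm (\<zeta> t - z)) \<le> 2 * \<bar>Re (g (\<zeta> t))\<bar> * 2"
      by (intro mult_left_mono) auto
    thus "norm (of_real (2 * Re (g (\<zeta> t))) * \<zeta> t / (\<zeta> t - z)) \<le> 4 * \<bar>Re (g (\<zeta> t))\<bar>"
      by (simp add: norm_mult norm_divide n\<zeta>)
  qed (use i3 int in auto)
  hence "norm (2 * of_real pi * (g z + cnj (g 0))) \<le> 4 * integral {0..2*pi} (\<lambda>t. \<bar>Re (g (\<zeta> t))\<bar>)"
    using integral_unique[OF i3] by (simp only: integral_mult_right)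
  moreover have "norm (2 * of_real pi * (g z + cnj (g 0))) = 2 * pi * norm (g z + cnj (g 0))"
    by (simp only: norm_mult norm_of_real norm_numeral) simp
  ultimately have "norm (g z + cnj (g 0)) \<le> 2 / pi * integral {0..2*pi} (\<lambda>t. \<bar>Re (g (\<zeta> t))\<bar>)"
    using pi_gt_zero by (simp add: divide_simps mult_ac)
  moreover have "norm (g z) \<le> norm (g z + cnj (g 0)) + norm (g 0)"
    using norm_triangle_ineq4[of "g z + cnj (g 0)" "cnj (g 0)"] by simp
  ultimately show ?thesis
    by (simp add: \<zeta>_def)
qed

text \<open>|x| = 2 max(0, x) - x, and the mean value property evaluates the integral of the last
  term. Thus an upper bound for the positive part of Re g controls the negative part as
  well.\<close>

lemma integral_abs_Re_entire:
  assumes hol: "g holomorphic_on UNIV" and r: "r > 0"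
  shows "integral {0..2*pi} (\<lambda>t. \<bar>Re (g (of_real r * cis t))\<bar>)
    = 2 * integral {0..2*pi} (\<lambda>t. max 0 (Re (g (of_real r * cis t)))) - 2 * pi * Re (g 0)"
proof -
  have cont: "continuous_on {0..2*pi} (\<lambda>t. g (of_real r * cis t))"
    by (intro continuous_on_compose2[OF holomorphic_on_imp_continuous_on[OF hol]] continuous_intros) auto
  have "((\<lambda>t. g (of_real r * cis t)) has_integral 2 * of_real pi * g 0) {0..2*pi}"
    using has_integral_Cauchy_circle[of g r 0] r holomorphic_on_subset[OF hol] by simp
  from has_integral_Re[OF this]
  have i1: "((\<lambda>t. Re (g (of_real r * cis t))) has_integral 2 * pi * Re (g 0)) {0..2*pi}"
    by simp
  have "integral {0..2*pi} (\<lambda>t. \<bar>Re (g (of_real r * cis t))\<bar>)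
      = integral {0..2*pi} (\<lambda>t. 2 * max 0 (Re (g (of_real r * cis t))) - Re (g (of_real r * cis t)))"
    by (rule arg_cong[where f = "integral _"]) (auto simp: fun_eq_iff)
  also have "\<dots> = integral {0..2*pi} (\<lambda>t. 2 * max 0 (Re (g (of_real r * cis t)))) - 2 * pi * Re (g 0)"
    by (subst Henstock_Kurzweil_Integration.integral_diff)
      (use i1 in \<open>auto intro!: integrable_continuous_interval continuous_intros cont simp: integral_unique\<close>)
  finally show ?thesis by simp
qed

subsection \<open>Entire functions with finitely many zeros\<close>

text \<open>Induction on the number of distinct zeros: each step divides out one zero with its full
  multiplicity, and a zero-free entire function has a logarithm because the plane is
  contractible.\<close>

lemma entire_finite_zeros_factorization:
  assumes "F holomorphic_on UNIV" "finite {z. F z = 0}"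
  obtains p :: "complex poly" and g
    where "p \<noteq> 0" "g holomorphic_on UNIV" "\<And>z. F z = poly p z * exp (g z)"
proof -
  have "\<exists>p g. p \<noteq> 0 \<and> g holomorphic_on UNIV \<and> (\<forall>z. F z = poly p z * exp (g z))"
    using assms
  proof (induction "card {z. F z = 0}" arbitrary: F)
    case 0
    hence "{z. F z = 0} = {}"
      using card_0_eq[OF "0"(3)] by simp
    hence nz: "F z \<noteq> 0" for z by blast
    obtain g where "g holomorphic_on UNIV" "\<And>z. F z = exp (g z)"
      by (rule contractible_imp_holomorphic_log[OF "0"(2) contractible_UNIV nz]) simp_all
    thus ?case by (intro exI[of _ 1] exI[of _ g]) simp
  next
    case (Suc n)
    have "{z. F z = 0} \<noteq> {}"
    proof
      assume "{z. F z = 0} = {}"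
      with Suc.hyps(2) show False by (simp only: card.empty)
    qed
    then obtain a where a: "F a = 0" by blast
    have "\<not> F constant_on UNIV"
    proof
      assume "F constant_on UNIV"
      hence "{z. F z = 0} = UNIV"
        using a by (auto simp: constant_on_def)
      with Suc.prems(2) show False
        using infinite_UNIV_char_0[where ?'a = complex] by simp
    qed
    then obtain h r k where k: "0 < (k::nat)" and r: "0 < r" and h: "h holomorphic_on ball a r"
      and Fh: "\<And>z. z \<in> ball a r \<Longrightarrow> F z = (z - a) ^ k * h z"
      and h0: "\<And>z. z \<in> ball a r \<Longrightarrow> h z \<noteq> 0"
      by (rule holomorphic_factor_zero_nonconstant[OF Suc.prems(1) open_UNIV connected_UNIV UNIV_I a]) auto
    \<comment> \<open>The quotient of \<open>F\<close> by \<open>(z - a) ^ k\<close>, with the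
      removable singularity at \<open>a\<close> filled in by the local factor \<open>h\<close>; the
      two expressions agree on the punctured ball.\<close>
    define H where "H = (\<lambda>z. if z \<in> ball a r then h z else F z / (z - a) ^ k)"
    have FH: "F z = (z - a) ^ k * H z" for z
      using Fh r by (auto simp: H_def)
    have "H holomorphic_on ball a r"
      using h by (rule holomorphic_transform) (auto simp: H_def)
    moreover have "H holomorphic_on - {a}"
    proof (rule holomorphic_transform)
      show "(\<lambda>z. F z / (z - a) ^ k) holomorphic_on - {a}"
        by (intro holomorphic_intros holomorphic_on_subset[OF Suc.prems(1)]) auto
    qed (use FH in auto)
    ultimately have "H holomorphic_on (ball a r \<union> - {a})"
      by (intro holomorphic_on_Un) auto
    moreover have "ball a r \<union> - {a} = UNIV"
      using r by auto
    ultimately have holH: "H holomorphic_on UNIV" by simp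
    have "H a \<noteq> 0"
      using h0[of a] r by (simp add: H_def)
    hence zeros: "{z. H z = 0} = {z. F z = 0} - {a}"
      using FH k by (auto simp: power_0_left)
    have "n = card {z. H z = 0}"
      using Suc.hyps(2) Suc.prems(2) a by (simp add: zeros)
    then obtain p g where pg: "p \<noteq> 0" "g holomorphic_on UNIV" "\<forall>z. H z = poly p z * exp (g z)"
      using Suc.hyps(1)[OF _ holH] Suc.prems(2) by (auto simp: zeros)
    show ?case
      using pg FH by (intro exI[of _ "[:-a, 1:] ^ k * p"] exI[of _ g]) (auto simp: poly_power)
  qed
  thus ?thesis using that by blast
qed

section \<open>Unit discs on which exp g is bounded, with exponentially small value at the
  centre\<close>

text \<open>The hypotheses do separate work: \<open>nonconst\<close> bounds A from below by a linear
  function, and \<open>growth\<close> supplies radii at which A grows little over a step of length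
  2. That length is the radius of the ball about z0 on which Harnack's inequality is applied, which
  may reach out to |z| = r + 2.\<close>

lemma exists_deep_disc:
  assumes hol: "g holomorphic_on UNIV" and nonconst: "deriv g \<zeta> \<noteq> 0"
    and growth: "\<And>\<delta>. \<delta> > 0 \<Longrightarrow>
      eventually (\<lambda>r. \<forall>z. norm z \<le> r \<longrightarrow> norm (g z) \<le> exp (\<delta> * r)) at_top"
  obtains c C where "c > 0" "\<And>R. \<exists>z0. norm z0 \<ge> R \<and> c * norm z0 - C \<le> - Re (g z0)
    \<and> (\<forall>z\<in>cball z0 1. Re (g z) \<le> 0)"
proof -
  define A where "A = (\<lambda>r. Sup ((\<lambda>z. - Re (g z)) ` cball 0 r))"
  have cont: "continuous_on S (\<lambda>z. - Re (g z))" for S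
    by (intro continuous_intros continuous_on_subset[OF holomorphic_on_imp_continuous_on[OF hol]]) auto
  have bdd: "bdd_above ((\<lambda>z. - Re (g z)) ` cball 0 r)" for r
    by (intro bounded_imp_bdd_above compact_imp_bounded compact_continuous_image cont compact_cball)
  have A_ge: "- Re (g z) \<le> A r" if "norm z \<le> r" for z r
    unfolding A_def using that by (intro cSup_upper bdd) auto
  have A_att: "\<exists>z. norm z \<le> r \<and> A r = - Re (g z)" if "r \<ge> 0" for r
  proof -
    have "cball (0::complex) r \<noteq> {}" using that by auto
    then obtain x where x: "x \<in> cball 0 r" "\<And>y. y \<in> cball 0 r \<Longrightarrow> - Re (g y) \<le> - Re (g x)"
      using continuous_attains_sup[OF compact_cball _ cont] by blast
    have "A r = - Re (g x)"
      unfolding A_def using x by (intro cSup_eq_maximum) auto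
    thus ?thesis using x by auto
  qed
  have A_mono: "A r \<le> A s" if "0 \<le> r" "r \<le> s" for r s
    using A_att[OF that(1)] A_ge[of _ s] that by force
  have diff: "g field_differentiable at z" for z
    using hol by (auto simp: holomorphic_on_def)
  \<comment> \<open>Both constants are read off from |g'(\<zeta>)| <= 2 (Re g(\<zeta>) + A(r) + 1) /
    (r - |\<zeta>|), the derivative bound behind \<open>lin\<close>. The summand 1 makes the shifted
    real part strictly positive.\<close>
  define c where "c = norm (deriv g \<zeta>) / 2"
  define C where "C = c * norm \<zeta> + Re (g \<zeta>) + 1"
  have c: "c > 0" using nonconst by (simp add: c_def)
  have lin: "c * r - C \<le> A r" if r: "r > norm \<zeta>" for r
  proof -
    define f where "f = (\<lambda>z. g z + of_real (A r + 1))"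
    have "norm (deriv f \<zeta>) \<le> 2 * Re (f \<zeta>) / (r - norm \<zeta>)"
    proof (rule norm_deriv_le_Re)
      show "f holomorphic_on ball \<zeta> (r - norm \<zeta>)"
        unfolding f_def by (intro holomorphic_intros holomorphic_on_subset[OF hol]) auto
      show "0 < Re (f z)" if "z \<in> ball \<zeta> (r - norm \<zeta>)" for z
      proof -
        have "norm z \<le> r"
          using norm_triangle_ineq[of \<zeta> "z - \<zeta>"] that by (simp add: dist_norm norm_minus_commute)
        from A_ge[OF this] show ?thesis by (simp add: f_def)
      qed
    qed (use r in auto)
    moreover have "deriv f \<zeta> = deriv g \<zeta>"
      unfolding f_def using diff by simp
    ultimately have "2 * c * (r - norm \<zeta>) \<le> 2 * (Re (g \<zeta>) + A r + 1)"
      using r by (simp add: c_def f_def field_simps)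
    thus ?thesis by (simp add: C_def algebra_simps)
  qed
  show ?thesis
  proof (rule that[OF c])
    fix R :: real
    define R' where "R' = max 0 R"
    \<comment> \<open>Beyond \<open>r1\<close> the linear bound gives \<open>A r >= 4\<close>, used
      in the Harnack estimate, and \<open>A r >= A R' + 1\<close>, which forces a maximum point of
      -Re g out of the disc of radius \<open>R'\<close>.\<close>
    define r1 where "r1 = max (max R' (norm \<zeta> + 1)) ((C + max 4 (A R' + 1)) / c)"
    have r1: "r1 \<ge> 0" "r1 \<ge> norm \<zeta> + 1" "r1 \<ge> R'"
      by (auto simp: r1_def R'_def)
    have "(C + max 4 (A R' + 1)) / c \<le> r1"
      by (simp add: r1_def)
    hence r1c: "C + max 4 (A R' + 1) \<le> c * r1"
      using c by (simp only: pos_divide_le_eq mult.commute)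
    have big: "A r \<ge> 4" "A r \<ge> A R' + 1" if "r \<ge> r1" for r
    proof -
      have "c * r1 \<le> c * r" using that c by simp
      thus "A r \<ge> 4" "A r \<ge> A R' + 1"
        using lin[of r] r1 r1c that by auto
    qed
    have "\<exists>r\<ge>r1. A (r + 2) \<le> 7/6 * A r"
    proof (rule ccontr)
      assume "\<not> ?thesis"
      hence *: "A (r + 2) > 7/6 * A r" if "r \<ge> r1" for r
        using that by auto
      have pow: "A (r1 + 2 * real n) \<ge> (7/6) ^ n * 4" for n
      proof (induction n)
        case 0
        thus ?case using big[of r1] by simp
      next
        case (Suc n)
        thus ?case using *[of "r1 + 2 * real n"] by (simp add: algebra_simps)
      qed
      \<comment> \<open>Chosen so that exp(4 \<delta> n) = (7/6)^n. At r = r1 + 2 n with n > r1 the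
        growth bound allows only exp(\<delta> r) < exp(3 \<delta> n), a contradiction.\<close>
      define \<delta> :: real where "\<delta> = ln (7/6) / 4"
      have \<delta>: "\<delta> > 0" by (simp add: \<delta>_def)
      obtain K where K: "\<And>r z. r \<ge> K \<Longrightarrow> norm z \<le> r \<Longrightarrow> norm (g z) \<le> exp (\<delta> * r)"
        using growth[OF \<delta>] by (auto simp: eventually_at_top_linorder)
      obtain n :: nat where n: "real n > max r1 K"
        using reals_Archimedean2 by blast
      define r where "r = r1 + 2 * real n"
      have r: "r \<ge> 0" "r \<ge> K" using n r1 by (auto simp: r_def)
      from A_att[OF r(1)] obtain z where z: "norm z \<le> r" "A r = - Re (g z)" by blast
      have "(7/6 :: real) ^ n = exp (4 * \<delta>) ^ n"
        by (simp add: \<delta>_def)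
      hence "exp (4 * \<delta> * real n) = (7/6) ^ n"
        by (simp add: exp_of_nat_mult[symmetric] mult_ac)
      also have "\<dots> \<le> A r"
        using pow[of n] unfolding r_def[symmetric] using zero_le_power[of "7/6 :: real" n] by linarith
      also have "\<dots> \<le> norm (g z)"
        using abs_Re_le_cmod[of "g z"] z by linarith
      also have "\<dots> \<le> exp (\<delta> * r)"
        using K[OF r(2) z(1)] .
      finally have "\<delta> * (4 * real n) \<le> \<delta> * r" by (simp add: mult_ac)
      hence "4 * real n \<le> r" using \<delta> by simp
      thus False using n by (simp add: r_def)
    qed
    then obtain r where r: "r \<ge> r1" and Ar: "A (r + 2) \<le> 7/6 * A r" by blast
    obtain z0 where z0: "norm z0 \<le> r" "A r = - Re (g z0)"
      using A_att[of r] r r1 by auto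
    have "R \<le> norm z0"
    proof (rule ccontr)
      assume "\<not> ?thesis"
      hence "norm z0 \<le> R'" by (simp add: R'_def)
      from A_ge[OF this] show False using big[OF r] z0 by simp
    qed
    moreover have "c * norm z0 - C \<le> - Re (g z0)"
    proof -
      have "c * norm z0 \<le> c * r" using c z0 by simp
      thus ?thesis using lin[of r] r r1 z0 by simp
    qed
    moreover have "Re (g z) \<le> 0" if z: "z \<in> cball z0 1" for z
    proof -
      define f where "f = (\<lambda>z. g z + of_real (A (r + 2) + 1))"
      have f_pos: "0 < Re (f z)" if "z \<in> ball z0 2" for z
      proof -
        have "norm z \<le> r + 2"
          using norm_triangle_ineq[of z0 "z - z0"] that z0 by (simp add: dist_norm norm_minus_commute)
        from A_ge[OF this] show ?thesis by (simp add: f_def)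
      qed
      have holf: "f holomorphic_on ball z0 2"
        unfolding f_def by (intro holomorphic_intros holomorphic_on_subset[OF hol]) auto
      have d: "dist z z0 \<le> 1" using z by (simp add: dist_commute)
      have zb: "z \<in> ball z0 2" using d by (simp add: dist_commute)
      have "1 * Re (f z) \<le> (2 - dist z z0) * Re (f z)"
        using d f_pos[OF zb] by (intro mult_right_mono) auto
      also have "\<dots> \<le> (2 + dist z z0) * Re (f z0)"
        by (rule Harnack_Re_upper[OF _ holf f_pos zb]) auto
      also have "\<dots> \<le> 3 * Re (f z0)"
        using d f_pos[of z0] by (intro mult_right_mono) auto
      \<comment> \<open>Since \<open>Re (g z0) = - A r\<close> and
        \<open>A (r + 2) <= 7/6 * A r\<close>, the right side is at most 2 - 2/3 A(r), which is
        negative as A(r) >= 4. Any factor below 3/2 would serve, with a larger lower bound for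
        A(r).\<close>
      finally have "Re (g z) \<le> 3 * Re (g z0) + 2 * A (r + 2) + 2"
        by (simp add: f_def)
      thus ?thesis using z0 Ar big[OF r] by linarith
    qed
    ultimately show "\<exists>z0. norm z0 \<ge> R \<and> c * norm z0 - C \<le> - Re (g z0) \<and> (\<forall>z\<in>cball z0 1. Re (g z) \<le> 0)"
      by blast
  qed
qed
subsection \<open>Growth\<close>

lemma log_plus_conv_ln_max: "log_plus x = ln (max 1 x)"
  by (simp add: log_plus_def max_def)

lemma not_is_pole_entire: "w holomorphic_on UNIV \<Longrightarrow> \<not> is_pole w z"
  using not_is_pole_holomorphic[of UNIV z w] by simp

lemma nevanlinna_T_entire:
  assumes "w holomorphic_on UNIV"
  shows "nevanlinna_T w r = proximity_fun w r"
  using not_is_pole_entire[OF assms]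
  by (simp add: nevanlinna_T_def counting_fun_def pole_count_def)

text \<open>The summand 1 in the exponent absorbs the radii with T <= e, where the totalised
  iterated logarithm need not control T.\<close>

lemma eventually_nevanlinna_T_le:
  assumes "hyper_order w < 1"
  obtains s where "0 < s" "s < 1"
    "eventually (\<lambda>r. nevanlinna_T w r \<le> exp (1 + r powr s)) at_top"
proof -
  \<comment> \<open>The maximum with 0 makes \<open>s\<close> positive even if the hyper-order is
    negative.\<close>
  have "max 0 (hyper_order w) < 1"
    using assms by simp
  then obtain s where s: "ereal s < 1" "max 0 (hyper_order w) < ereal s"
    using ereal_dense2 by blast
  have s01: "0 < s" "s < 1"
    using le_less_trans[OF max.cobounded1 s(2)] s(1) by simp_all
  have "hyper_order w < ereal s"
    using s by simp
  hence "eventually (\<lambda>r. ereal (ln (ln (nevanlinna_T w r)) / ln r) < ereal s) at_top"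
    unfolding hyper_order_def by (rule Limsup_lessD)
  hence "eventually (\<lambda>r. nevanlinna_T w r \<le> exp (1 + r powr s)) at_top"
    using eventually_gt_at_top[of 1]
  proof eventually_elim
    case (elim r)
    define T where "T = nevanlinna_T w r"
    show ?case
    proof (cases "T \<le> exp 1")
      case True
      also have "exp 1 \<le> exp (1 + r powr s)" by simp
      finally show ?thesis by (simp add: T_def)
    next
      case False
      hence "T > exp 1" by simp
      hence T: "ln T > 1" "T > 0"
        by (metis exp_gt_zero ln_exp ln_less_cancel_iff less_trans, metis exp_gt_zero less_trans)
      have "ln (ln T) < s * ln r"
        using elim by (simp add: T_def field_simps)
      hence "ln T < exp (s * ln r)"
        using T by (metis exp_less_mono exp_ln less_trans zero_less_one)
      also have "exp (s * ln r) = r powr s"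
        using elim by (simp add: powr_def)
      finally have "T \<le> exp (r powr s)"
        using T by (metis exp_le_cancel_iff exp_ln less_imp_le)
      also have "\<dots> \<le> exp (1 + r powr s)" by simp
      finally show ?thesis by (simp add: T_def)
    qed
  qed
  with s01 that show ?thesis by blast
qed

text \<open>Taking logarithms in \<open>bound\<close> gives Re g <= N ln |z| + ln 2 + log+ |w|, so
  the mean of the positive part of Re g over a circle is at most the characteristic of w plus O(log
  r). The mean value property and the Schwarz formula turn this into a bound for |g|.\<close>

lemma subexponential_growth_of_logarithm:
  assumes hol: "g holomorphic_on UNIV" and w: "w holomorphic_on UNIV" and ho: "hyper_order w < 1"
    and bound: "eventually (\<lambda>z. norm (exp (g z)) \<le> norm z ^ N * (1 + norm (w z))) at_infinity"
    and \<delta>: "\<delta> > 0"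
  shows "eventually (\<lambda>r. \<forall>z. norm z \<le> r \<longrightarrow> norm (g z) \<le> exp (\<delta> * r)) at_top"
proof -
  obtain s where s: "0 < s" "s < 1"
    and T: "eventually (\<lambda>r. nevanlinna_T w r \<le> exp (1 + r powr s)) at_top"
    using eventually_nevanlinna_T_le[OF ho] .
  obtain B where B: "\<And>z. norm z \<ge> B \<Longrightarrow> norm (exp (g z)) \<le> norm z ^ N * (1 + norm (w z))"
    using bound by (auto simp: eventually_at_infinity)
  obtain K where K: "\<And>r. r \<ge> K \<Longrightarrow> proximity_fun w r \<le> exp (1 + r powr s)"
    using T by (auto simp: eventually_at_top_linorder nevanlinna_T_entire[OF w])
  have cont: "continuous_on {0..2*pi} (\<lambda>t. h (of_real r * cis t))" if "h holomorphic_on UNIV" for h r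
    by (intro continuous_on_compose2[OF holomorphic_on_imp_continuous_on[OF that]] continuous_intros) auto
  have contlp: "continuous_on {0..2*pi} (\<lambda>t. log_plus (norm (w (of_real r * cis t))))" for r
    unfolding log_plus_conv_ln_max by (intro continuous_intros cont w) auto
  define C where "C = norm (g 0) + 4 * \<bar>Re (g 0)\<bar>"
  have main: "norm (g z) \<le> C + 8 * (real N * ln R + ln 2 + exp (1 + R powr s))"
    if R: "R \<ge> max 1 (max B K)" and z: "norm z \<le> R / 2" for R z
  proof -
    have R0: "R > 0" using R by simp
    have pt: "max 0 (Re (g u)) \<le> real N * ln R + ln 2 + log_plus (norm (w u))" if u: "norm u = R" for u
    proof -
      define m where "m = max 1 (norm (w u))"
      have m: "m \<ge> 1" by (simp add: m_def)
      have "norm (exp (g u)) \<le> R ^ N * (1 + norm (w u))"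
        using B[of u] u R by simp
      also have "\<dots> \<le> R ^ N * (2 * m)"
        using R0 by (intro mult_left_mono) (auto simp: m_def)
      finally have "exp (Re (g u)) \<le> R ^ N * (2 * m)" by simp
      hence "Re (g u) \<le> ln (R ^ N * (2 * m))"
        using R0 m by (subst ln_ge_iff) auto
      also have "\<dots> = real N * ln R + ln 2 + ln m"
        using R0 m by (simp add: ln_mult_pos ln_realpow)
      finally have "Re (g u) \<le> real N * ln R + ln 2 + ln m" .
      moreover have "0 \<le> real N * ln R + ln 2 + ln m"
        using R m by simp
      ultimately show ?thesis by (simp add: log_plus_conv_ln_max m_def)
    qed
    have "integral {0..2*pi} (\<lambda>t. max 0 (Re (g (of_real R * cis t))))
        \<le> integral {0..2*pi} (\<lambda>t. (real N * ln R + ln 2) + log_plus (norm (w (of_real R * cis t))))"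
      using R0
      by (intro integral_le integrable_continuous_interval continuous_intros cont hol contlp pt)
        (auto simp: norm_mult)
    also have "\<dots> = 2 * pi * (real N * ln R + ln 2) + 2 * pi * proximity_fun w R"
      by (subst Henstock_Kurzweil_Integration.integral_add)
        (auto intro!: integrable_continuous_interval continuous_intros contlp simp: proximity_fun_def)
    also have "\<dots> \<le> 2 * pi * (real N * ln R + ln 2) + 2 * pi * exp (1 + R powr s)"
      using K[of R] R by simp
    finally have I: "integral {0..2*pi} (\<lambda>t. max 0 (Re (g (of_real R * cis t))))
        \<le> 2 * pi * (real N * ln R + ln 2 + exp (1 + R powr s))"
      by (simp add: algebra_simps)
    define J where "J = integral {0..2*pi} (\<lambda>t. max 0 (Re (g (of_real R * cis t))))"
    have "norm (g z) \<le> norm (g 0) + 2 / pi * (2 * J - 2 * pi * Re (g 0))"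
      using norm_entire_le_integral_abs_Re[OF hol R0 z]
      unfolding integral_abs_Re_entire[OF hol R0] J_def .
    also have "2 / pi * (2 * J - 2 * pi * Re (g 0)) = 4 / pi * J - 4 * Re (g 0)"
      by (simp add: field_simps)
    also have "4 / pi * J \<le> 4 / pi * (2 * pi * (real N * ln R + ln 2 + exp (1 + R powr s)))"
      using I unfolding J_def by (intro mult_left_mono) auto
    also have "\<dots> = 8 * (real N * ln R + ln 2 + exp (1 + R powr s))"
      by simp
    finally show ?thesis unfolding C_def by linarith
  qed
  \<comment> \<open>The radius is 2 r because the Schwarz bound covers the disc of half the radius.
    As s < 1, the term exp(1 + (2 r)^s) is eventually below exp(\<delta> r).\<close>
  have "eventually (\<lambda>r. C + 8 * (real N * ln (2 * r) + ln 2 + exp (1 + (2 * r) powr s)) \<le> exp (\<delta> * r)) at_top"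
    using s \<delta> by real_asymp
  moreover have "eventually (\<lambda>r. r \<ge> max 1 (max B K)) at_top"
    by (rule eventually_ge_at_top)
  ultimately show ?thesis
  proof eventually_elim
    case (elim r)
    show ?case
    proof (intro allI impI)
      fix z :: complex assume "norm z \<le> r"
      thus "norm (g z) \<le> exp (\<delta> * r)"
        using main[of "2 * r" z] elim by simp
    qed
  qed
qed

subsection \<open>Rational functions near infinity\<close>

lemma eventually_norm_ge_at_infinity: "eventually (\<lambda>z. K \<le> norm z) at_infinity"
  by (auto simp: eventually_at_infinity)

lemma eventually_poly_neq_0_at_infinity:
  fixes p :: "complex poly"
  assumes "p \<noteq> 0"
  shows "eventually (\<lambda>z. poly p z \<noteq> 0) at_infinity"
proof -
  obtain B where B: "\<And>z. poly p z = 0 \<Longrightarrow> norm z \<le> B"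
    using finite_imp_bounded[OF poly_roots_finite[OF assms]] by (auto simp: bounded_iff)
  show ?thesis
    using eventually_norm_ge_at_infinity[of "B + 1"] by eventually_elim (use B in force)
qed

text \<open>Here and below bounds near infinity are pure powers of |z|: constants are absorbed by
  raising the exponent, so that later estimates only add exponents.\<close>

lemma eventually_poly_le_power_at_infinity:
  fixes p :: "complex poly"
  shows "\<exists>N. eventually (\<lambda>z. norm (poly p z) \<le> norm z ^ N) at_infinity"
proof (induction p)
  case (pCons c p)
  then obtain N where "eventually (\<lambda>z. norm (poly p z) \<le> norm z ^ N) at_infinity" by blast
  hence "eventually (\<lambda>z. norm (poly (pCons c p) z) \<le> norm z ^ (N + 2)) at_infinity"
    using eventually_norm_ge_at_infinity[of "1 + norm c"]
  proof eventually_elim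
    case (elim z)
    define x where "x = norm z"
    have x: "x \<ge> 1" "norm c \<le> x - 1"
      using elim norm_ge_zero[of c] by (auto simp: x_def simp del: norm_ge_zero)
    have xN: "1 \<le> x ^ (N + 1)"
      using x by (intro one_le_power)
    have "norm (poly (pCons c p) z) \<le> norm c + x * norm (poly p z)"
      using norm_triangle_ineq[of c "z * poly p z"] by (simp add: norm_mult x_def)
    also have "\<dots> \<le> (x - 1) * x ^ (N + 1) + x * x ^ N"
    proof (rule add_mono)
      have "norm c \<le> (x - 1) * 1" using x by simp
      also have "\<dots> \<le> (x - 1) * x ^ (N + 1)"
        using x xN by (intro mult_left_mono) auto
      finally show "norm c \<le> (x - 1) * x ^ (N + 1)" .
    qed (use elim x in \<open>auto simp: x_def intro!: mult_left_mono\<close>)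
    also have "\<dots> = x ^ (N + 2)" by (simp add: algebra_simps)
    finally show ?case by (simp add: x_def)
  qed
  thus ?case by blast
qed auto

lemma eventually_poly_ge_at_infinity:
  fixes p :: "complex poly"
  assumes "p \<noteq> 0"
  shows "\<exists>c>0. eventually (\<lambda>z. c \<le> norm (poly p z)) at_infinity"
proof (cases p)
  case (pCons a q)
  show ?thesis
  proof (cases "q = 0")
    case True
    thus ?thesis using assms pCons by (intro exI[of _ "norm a"]) auto
  next
    case False
    thus ?thesis
      using poly_infinity[OF False, of 1 a] pCons
      by (intro exI[of _ 1]) (auto simp: eventually_at_infinity)
  qed
qed

text \<open>By coprimality the reduced denominator divides \<open>q\<close>, so it does not vanish
  at \<open>z\<close> either, and cross-multiplication compares the two quotients.\<close>

lemma rat_eval_Fract: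
  assumes "q \<noteq> 0" "poly q z \<noteq> 0"
  shows "rat_eval (Fract p q) z = poly p z / poly q z"
proof -
  define n where "n = fst (quot_of_fract (Fract p q))"
  define d where "d = snd (quot_of_fract (Fract p q))"
  have d: "d \<noteq> 0" by (simp add: d_def)
  have "Fract n d = Fract p q"
    unfolding n_def d_def by (rule Fract_quot_of_fract)
  hence eq: "n * q = p * d"
    using eq_fract(1)[OF d assms(1)] by simp
  have "coprime n d"
    unfolding n_def d_def by (rule coprime_quot_of_fract)
  moreover have "d dvd n * q" by (simp add: eq)
  ultimately have "d dvd q"
    by (metis coprime_commute coprime_dvd_mult_right_iff)
  hence dz: "poly d z \<noteq> 0"
    using assms(2) by auto
  have "poly n z * poly q z = poly p z * poly d z"
    using eq by (metis poly_mult)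
  thus ?thesis
    using dz assms(2) by (simp add: rat_eval_def n_def[symmetric] d_def[symmetric] field_simps)
qed

lemma rat_eval_0 [simp]: "rat_eval 0 z = 0"
  and rat_eval_1 [simp]: "rat_eval 1 z = 1"
  by (simp_all add: rat_eval_def)

text \<open>Only near infinity: at a pole the value is 0 by convention and additivity can
  fail.\<close>

lemma eventually_rat_eval_add:
  "eventually (\<lambda>z. rat_eval (r + s) z = rat_eval r z + rat_eval s z) at_infinity"
proof (cases r, cases s)
  fix a b c d assume rs: "r = Fract a b" "b \<noteq> 0" "s = Fract c d" "d \<noteq> 0"
  show ?thesis
    using eventually_poly_neq_0_at_infinity[OF rs(2)] eventually_poly_neq_0_at_infinity[OF rs(4)]
    by eventually_elim (use rs in \<open>simp add: rat_eval_Fract add_frac_eq\<close>)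
qed

lemma eventually_rat_eval_mult:
  "eventually (\<lambda>z. rat_eval (r * s) z = rat_eval r z * rat_eval s z) at_infinity"
proof (cases r, cases s)
  fix a b c d assume rs: "r = Fract a b" "b \<noteq> 0" "s = Fract c d" "d \<noteq> 0"
  show ?thesis
    using eventually_poly_neq_0_at_infinity[OF rs(2)] eventually_poly_neq_0_at_infinity[OF rs(4)]
    by eventually_elim (use rs in \<open>simp add: rat_eval_Fract\<close>)
qed

lemma eventually_isCont_rat_eval: "eventually (isCont (rat_eval r)) at_infinity"
  using eventually_poly_neq_0_at_infinity[OF snd_quot_of_fract_nonzero[of r]]
  unfolding rat_eval_def by eventually_elim (intro continuous_intros)

lemma eventually_rat_eval_le_power:
  "\<exists>N. eventually (\<lambda>z. norm (rat_eval r z) \<le> norm z ^ N) at_infinity"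
proof -
  define p where "p = fst (quot_of_fract r)"
  define q where "q = snd (quot_of_fract r)"
  have r: "rat_eval r z = poly p z / poly q z" for z
    by (simp add: rat_eval_def p_def q_def)
  have "q \<noteq> 0" by (simp add: q_def)
  then obtain c where c: "c > 0" "eventually (\<lambda>z. c \<le> norm (poly q z)) at_infinity"
    using eventually_poly_ge_at_infinity by blast
  obtain N where N: "eventually (\<lambda>z. norm (poly p z) \<le> norm z ^ N) at_infinity"
    using eventually_poly_le_power_at_infinity by blast
  have "eventually (\<lambda>z. norm (rat_eval r z) \<le> norm z ^ (N + 1)) at_infinity"
    using c(2) N eventually_norm_ge_at_infinity[of "1 / c"]
  proof eventually_elim
    case (elim z)
    have "norm (rat_eval r z) \<le> norm z ^ N / c"
      unfolding r norm_divide using elim c by (intro frac_le) auto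
    also have "\<dots> = 1 / c * norm z ^ N" by simp
    also have "\<dots> \<le> norm z * norm z ^ N"
      using elim by (intro mult_right_mono) auto
    finally show ?case by simp
  qed
  thus ?thesis by blast
qed

text \<open>The upper bound for \<open>inverse r\<close>, read backwards.\<close>

lemma eventually_rat_eval_ge_power:
  assumes "r \<noteq> 0"
  shows "\<exists>N. eventually (\<lambda>z. 1 \<le> norm z ^ N * norm (rat_eval r z)) at_infinity"
proof -
  obtain N where "eventually (\<lambda>z. norm (rat_eval (inverse r) z) \<le> norm z ^ N) at_infinity"
    using eventually_rat_eval_le_power by blast
  hence "eventually (\<lambda>z. 1 \<le> norm z ^ N * norm (rat_eval r z)) at_infinity"
    using eventually_rat_eval_mult[of "inverse r" r]
  proof eventually_elim
    case (elim z)
    have "1 = norm (rat_eval (inverse r) z * rat_eval r z)"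
      using elim(2) assms by simp
    also have "\<dots> \<le> norm z ^ N * norm (rat_eval r z)"
      unfolding norm_mult using elim by (intro mult_right_mono) auto
    finally show ?case .
  qed
  thus ?thesis by blast
qed

lemma poly_eval_0 [simp]: "poly_eval 0 z w = 0"
  by (simp add: poly_eval_def)

lemma poly_eval_pCons [simp]: "poly_eval (pCons c P) z w = rat_eval c z + w * poly_eval P z w"
  by (simp add: poly_eval_def map_poly_pCons)

text \<open>Carries the algebraic facts \<open>poly Q b = 0\<close> and
  \<open>poly P b \<noteq> 0\<close> over to the values at points near infinity.\<close>

lemma eventually_poly_eval_rat_eval:
  "eventually (\<lambda>z. poly_eval P z (rat_eval b z) = rat_eval (poly P b) z) at_infinity"
proof (induction P)
  case (pCons c P)
  from pCons(2) eventually_rat_eval_add[of c "b * poly P b"] eventually_rat_eval_mult[of b "poly P b"]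
  show ?case by eventually_elim simp
qed simp

lemma eventually_isCont_poly_eval:
  assumes "\<And>z. isCont w z"
  shows "eventually (isCont (\<lambda>z. poly_eval P z (w z))) at_infinity"
proof (induction P)
  case (pCons c P)
  from pCons(2) eventually_isCont_rat_eval[of c] show ?case
    by eventually_elim (auto intro!: continuous_intros assms)
qed simp

lemma eventually_poly_eval_le_power:
  "\<exists>N. eventually (\<lambda>z. \<forall>w. norm w \<le> norm z ^ M \<longrightarrow> norm (poly_eval P z w) \<le> norm z ^ N) at_infinity"
proof (induction P)
  case (pCons c P)
  then obtain N where N: "eventually (\<lambda>z. \<forall>w. norm w \<le> norm z ^ M \<longrightarrow>
      norm (poly_eval P z w) \<le> norm z ^ N) at_infinity" by blast
  obtain K where K: "eventually (\<lambda>z. norm (rat_eval c z) \<le> norm z ^ K) at_infinity"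
    using eventually_rat_eval_le_power by blast
  have "eventually (\<lambda>z. \<forall>w. norm w \<le> norm z ^ M \<longrightarrow>
      norm (poly_eval (pCons c P) z w) \<le> norm z ^ (K + M + N + 1)) at_infinity"
    using N K eventually_norm_ge_at_infinity[of 2]
  proof eventually_elim
    case (elim z)
    show ?case
    proof (intro allI impI)
      fix w :: complex assume w: "norm w \<le> norm z ^ M"
      define x where "x = norm z"
      have x: "x \<ge> 2" using elim by (simp add: x_def)
      have "norm (poly_eval (pCons c P) z w) \<le> norm (rat_eval c z) + norm w * norm (poly_eval P z w)"
        using norm_triangle_ineq[of "rat_eval c z" "w * poly_eval P z w"] by (simp add: norm_mult)
      also have "\<dots> \<le> x ^ K + x ^ M * x ^ N"
        using elim w by (intro add_mono mult_mono) (auto simp: x_def)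
      also have "\<dots> \<le> x ^ (K + M + N) + x ^ (K + M + N)"
        using x unfolding power_add[symmetric] by (intro add_mono power_increasing) auto
      also have "\<dots> \<le> x * x ^ (K + M + N)"
        using x mult_right_mono[of 2 x "x ^ (K + M + N)"] by simp
      finally show "norm (poly_eval (pCons c P) z w) \<le> norm z ^ (K + M + N + 1)"
        by (simp add: x_def)
    qed
  qed
  thus ?case by blast
qed simp

text \<open>Applied with v the value of b: closeness of w to b makes Q(z,w) small and keeps P(z,w)
  near P(z,b).\<close>

lemma eventually_poly_eval_lipschitz:
  "\<exists>N. eventually (\<lambda>z. \<forall>u v. norm u \<le> norm z ^ M \<longrightarrow> norm v \<le> norm z ^ M \<longrightarrow>
     norm (poly_eval P z u - poly_eval P z v) \<le> norm z ^ N * norm (u - v)) at_infinity"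
proof (induction P)
  case (pCons c P)
  then obtain N where N: "eventually (\<lambda>z. \<forall>u v. norm u \<le> norm z ^ M \<longrightarrow> norm v \<le> norm z ^ M \<longrightarrow>
     norm (poly_eval P z u - poly_eval P z v) \<le> norm z ^ N * norm (u - v)) at_infinity" by blast
  obtain K where K: "eventually (\<lambda>z. \<forall>w. norm w \<le> norm z ^ M \<longrightarrow>
      norm (poly_eval P z w) \<le> norm z ^ K) at_infinity"
    using eventually_poly_eval_le_power by blast
  have "eventually (\<lambda>z. \<forall>u v. norm u \<le> norm z ^ M \<longrightarrow> norm v \<le> norm z ^ M \<longrightarrow>
     norm (poly_eval (pCons c P) z u - poly_eval (pCons c P) z v)
       \<le> norm z ^ (K + M + N + 1) * norm (u - v)) at_infinity"
    using N K eventually_norm_ge_at_infinity[of 2]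
  proof eventually_elim
    case (elim z)
    show ?case
    proof (intro allI impI)
      fix u v :: complex assume uv: "norm u \<le> norm z ^ M" "norm v \<le> norm z ^ M"
      define x where "x = norm z"
      have x: "x \<ge> 2" using elim by (simp add: x_def)
      have "poly_eval (pCons c P) z u - poly_eval (pCons c P) z v =
          u * (poly_eval P z u - poly_eval P z v) + (u - v) * poly_eval P z v"
        by (simp add: algebra_simps)
      also have "norm \<dots> \<le> norm u * norm (poly_eval P z u - poly_eval P z v) + norm (u - v) * norm (poly_eval P z v)"
        by (metis norm_mult norm_triangle_ineq)
      also have "\<dots> \<le> x ^ M * (x ^ N * norm (u - v)) + norm (u - v) * x ^ K"
        using elim uv by (intro add_mono mult_mono) (auto simp: x_def)
      also have "\<dots> = (x ^ (M + N) + x ^ K) * norm (u - v)"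
        by (simp add: algebra_simps power_add)
      also have "\<dots> \<le> (x ^ (K + M + N) + x ^ (K + M + N)) * norm (u - v)"
        using x by (intro mult_right_mono add_mono power_increasing) auto
      also have "\<dots> \<le> (x * x ^ (K + M + N)) * norm (u - v)"
        using x mult_right_mono[of 2 x "x ^ (K + M + N)"] by (intro mult_right_mono) auto
      finally show "norm (poly_eval (pCons c P) z u - poly_eval (pCons c P) z v)
          \<le> norm z ^ (K + M + N + 1) * norm (u - v)"
        by (simp add: x_def)
    qed
  qed
  thus ?case by blast
qed simp

subsection \<open>Entire solutions\<close>

text \<open>The exceptional points of \<open>is_solution\<close> may accumulate at infinity, yet the
  equation is needed at each far point that g or a zero of w - b dictates. Once multiplied out, both
  sides are continuous far out, and the exceptional points are isolated, so the identity extends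
  across them.\<close>

lemma is_solution_eventually:
  assumes w: "w holomorphic_on UNIV" and sol: "is_solution a P Q w"
  shows "eventually (\<lambda>z. poly_eval Q z (w z) * (w z * (w (z + 1) - w (z - 1)) + rat_eval a z * deriv w z)
    = w z * poly_eval P z (w z)) at_infinity"
proof -
  define D where "D = (\<lambda>z. poly_eval Q z (w z) * (w z * (w (z + 1) - w (z - 1)) + rat_eval a z * deriv w z)
    - w z * poly_eval P z (w z))"
  have cw: "isCont w z" for z
    using holomorphic_on_imp_continuous_on[OF w] by (simp add: continuous_on_eq_continuous_at)
  have cw': "isCont (deriv w) z" for z
    using holomorphic_on_imp_continuous_on[OF holomorphic_deriv[OF w open_UNIV]]
    by (simp add: continuous_on_eq_continuous_at)
  have cs: "isCont (\<lambda>z. w (z + s)) z" for s z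
    by (rule isCont_o2[where f = "\<lambda>z. z + s", OF _ cw]) (intro continuous_intros)
  have D0: "eventually (\<lambda>z. D z = 0) (at x)" for x
  proof -
    have "\<forall>\<^sub>\<approx>z. w z \<noteq> 0 \<and> poly_eval Q z (w z) \<noteq> 0 \<and>
        w (z + 1) - w (z - 1) + rat_eval a z * (deriv w z / w z) = poly_eval P z (w z) / poly_eval Q z (w z)"
      using sol by (simp add: is_solution_def)
    hence "\<forall>\<^sub>F z in at x. w z \<noteq> 0 \<and> poly_eval Q z (w z) \<noteq> 0 \<and>
        w (z + 1) - w (z - 1) + rat_eval a z * (deriv w z / w z) = poly_eval P z (w z) / poly_eval Q z (w z)"
      by (rule eventually_cosparse_imp_eventually_at) simp
    thus ?thesis
    proof eventually_elim
      case (elim z)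
      define q where "q = deriv w z / w z"
      have w': "deriv w z = q * w z"
        using elim by (simp add: q_def)
      have P: "poly_eval P z (w z) = (w (z + 1) - w (z - 1) + rat_eval a z * q) * poly_eval Q z (w z)"
        using elim unfolding q_def[symmetric] by (metis nonzero_eq_divide_eq)
      show "D z = 0"
        unfolding D_def w' P by (simp add: algebra_simps)
    qed
  qed
  have "eventually (\<lambda>z. D z = 0) at_infinity"
    using eventually_isCont_poly_eval[OF cw, of P] eventually_isCont_poly_eval[OF cw, of Q]
      eventually_isCont_rat_eval[of a]
  proof eventually_elim
    case (elim z)
    have "isCont D z"
      unfolding D_def using cs[where s = 1] cs[where s = "-1"] by (intro continuous_intros elim cw cw') auto
    hence "(D \<longlongrightarrow> D z) (at z)" by (simp add: isCont_def)
    moreover have "(D \<longlongrightarrow> 0) (at z)"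
      by (rule tendsto_eventually[OF D0])
    ultimately show ?case
      by (rule LIM_unique)
  qed
  thus ?thesis by eventually_elim (simp add: D_def)
qed

lemma poly_map_poly_to_ac: "poly (map_poly to_ac Q) (to_ac b) = to_ac (poly Q b)"
  by (induction Q) (simp_all add: map_poly_pCons)

lemma finite_zeros_entire:
  assumes "F holomorphic_on UNIV" "eventually (\<lambda>z. F z \<noteq> 0) at_infinity"
  shows "finite {z. F z = 0}"
proof -
  obtain B where B: "\<And>z. norm z \<ge> B \<Longrightarrow> F z \<noteq> 0"
    using assms(2) by (auto simp: eventually_at_infinity)
  show ?thesis
  proof (cases "F constant_on UNIV")
    case True
    have "F (of_real \<bar>B\<bar>) \<noteq> 0" by (rule B) simp
    hence "{z. F z = 0} = {}"
      using True by (metis (mono_tags, lifting) UNIV_I constant_on_def empty_Collect_eq)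
    thus ?thesis by simp
  next
    case False
    have "finite {z \<in> cball 0 B. F z = 0}"
      by (rule holomorphic_compact_finite_zeros[OF assms(1) _ _ _ _ False]) auto
    moreover have "{z. F z = 0} = {z \<in> cball 0 B. F z = 0}"
      using B by (force simp: not_le)
    ultimately show ?thesis by simp
  qed
qed

text \<open>If g were a constant c, then w would be the rational function (B1 + exp(c) p) / B2 off
  the roots of B2.\<close>

lemma transcendental_exponent_nonconst:
  assumes trans: "transcendental w" and B2: "B2 \<noteq> 0" and g: "g holomorphic_on UNIV"
    and eq: "\<And>z. poly B2 z * w z - poly B1 z = poly p z * exp (g z)"
  obtains \<zeta> where "deriv g \<zeta> \<noteq> 0"
proof (rule ccontr)
  assume "\<not> thesis"
  hence d0: "deriv g z = 0" for z
    using that by blast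
  have "\<exists>c. \<forall>z\<in>UNIV. g z = c"
  proof (rule has_field_derivative_zero_constant)
    fix z
    have "g field_differentiable at z"
      using g by (simp add: holomorphic_on_def)
    thus "(g has_field_derivative 0) (at z)"
      using d0[of z] field_differentiable_derivI by metis
  qed simp
  then obtain c where c: "\<And>z. g z = c" by blast
  define r where "r = Fract (B1 + Polynomial.smult (exp c) p) B2"
  have "finite {z. poly B2 z = 0}"
    by (rule poly_roots_finite[OF B2])
  hence "\<forall>\<^sub>\<approx>z. z \<notin> {z. poly B2 z = 0}"
    by (intro eventually_not_in_cosparse finite_imp_sparse)
  hence "\<forall>\<^sub>\<approx>z. w z = rat_eval r z"
  proof eventually_elim
    case (elim z)
    have "poly B2 z * w z = poly B1 z + poly p z * exp c"
      using eq[of z] by (simp add: c algebra_simps)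
    thus ?case
      using elim by (simp add: r_def rat_eval_Fract[OF B2] nonzero_eq_divide_eq mult.commute)
  qed
  thus False
    using trans by (auto simp: transcendental_def)
qed

lemma norm_deriv_le_of_norm_le_cball:
  assumes "w holomorphic_on UNIV" "\<And>z. z \<in> cball z0 1 \<Longrightarrow> norm (w z) \<le> B"
  shows "norm (deriv w z0) \<le> B"
  using Cauchy_inequality[of w z0 1 B 1] assms
  by (auto simp: dist_norm intro: holomorphic_on_subset holomorphic_on_imp_continuous_on)

section \<open>Contradiction at a point where w is exponentially close to b\<close>

lemma no_solution_near_root:
  assumes w: "w holomorphic_on UNIV" and sol: "is_solution a P Q w"
    and b: "poly Q b = 0" "b \<noteq> 0" "poly P b \<noteq> 0"
    and rep: "eventually (\<lambda>z. w z = rat_eval b z + rat_eval R z * exp (g z)) at_infinity"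
    and c: "c > 0"
    and deep: "\<And>K. \<exists>z0. norm z0 \<ge> K \<and> c * norm z0 - C \<le> - Re (g z0)
      \<and> (\<forall>z\<in>cball z0 1. Re (g z) \<le> 0)"
  shows False
proof -
  obtain na where na: "eventually (\<lambda>z. norm (rat_eval a z) \<le> norm z ^ na) at_infinity"
    using eventually_rat_eval_le_power by blast
  obtain nb where nb: "eventually (\<lambda>z. norm (rat_eval b z) \<le> norm z ^ nb) at_infinity"
    using eventually_rat_eval_le_power by blast
  obtain nR where nR: "eventually (\<lambda>z. norm (rat_eval R z) \<le> norm z ^ nR) at_infinity"
    using eventually_rat_eval_le_power by blast
  obtain kb where kb: "eventually (\<lambda>z. 1 \<le> norm z ^ kb * norm (rat_eval b z)) at_infinity"
    using eventually_rat_eval_ge_power[OF b(2)] by blast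
  obtain kP where kP: "eventually (\<lambda>z. 1 \<le> norm z ^ kP * norm (rat_eval (poly P b) z)) at_infinity"
    using eventually_rat_eval_ge_power[OF b(3)] by blast
  \<comment> \<open>Where |exp g| <= 1, the sum |z|^nb + |z|^nR bounds |w|; the extra 1 absorbs the
    factor 2. The same power bounds b.\<close>
  define M where "M = nb + nR + 1"
  obtain lP where lP: "eventually (\<lambda>z. \<forall>u v. norm u \<le> norm z ^ M \<longrightarrow> norm v \<le> norm z ^ M \<longrightarrow>
     norm (poly_eval P z u - poly_eval P z v) \<le> norm z ^ lP * norm (u - v)) at_infinity"
    using eventually_poly_eval_lipschitz by blast
  obtain lQ where lQ: "eventually (\<lambda>z. \<forall>u v. norm u \<le> norm z ^ M \<longrightarrow> norm v \<le> norm z ^ M \<longrightarrow>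
     norm (poly_eval Q z u - poly_eval Q z v) \<le> norm z ^ lQ * norm (u - v)) at_infinity"
    using eventually_poly_eval_lipschitz by blast
  \<comment> \<open>At least as large as every exponent that meets \<open>E\<close> below:
    \<open>kb + nR\<close> in \<open>wlow\<close>, \<open>kP + lP + nR\<close> in
    \<open>Plow\<close>, and the total exponent of the final comparison. One smallness condition
    then serves all three.\<close>
  define L where "L = kb + kP + lQ + nR + 4 * M + na + 2 + lP"
  define good where "good = (\<lambda>z.
      norm (rat_eval a z) \<le> norm z ^ na \<and> norm (rat_eval b z) \<le> norm z ^ nb \<and>
      norm (rat_eval R z) \<le> norm z ^ nR \<and> 1 \<le> norm z ^ kb * norm (rat_eval b z) \<and>
      1 \<le> norm z ^ kP * norm (rat_eval (poly P b) z) \<and>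
      (\<forall>u v. norm u \<le> norm z ^ M \<longrightarrow> norm v \<le> norm z ^ M \<longrightarrow>
         norm (poly_eval P z u - poly_eval P z v) \<le> norm z ^ lP * norm (u - v)) \<and>
      (\<forall>u v. norm u \<le> norm z ^ M \<longrightarrow> norm v \<le> norm z ^ M \<longrightarrow>
         norm (poly_eval Q z u - poly_eval Q z v) \<le> norm z ^ lQ * norm (u - v)) \<and>
      w z = rat_eval b z + rat_eval R z * exp (g z) \<and>
      poly_eval P z (rat_eval b z) = rat_eval (poly P b) z \<and>
      poly_eval Q z (rat_eval b z) = 0 \<and>
      poly_eval Q z (w z) * (w z * (w (z + 1) - w (z - 1)) + rat_eval a z * deriv w z)
        = w z * poly_eval P z (w z))"
  have evQ: "eventually (\<lambda>z. poly_eval Q z (rat_eval b z) = 0) at_infinity"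
    using eventually_poly_eval_rat_eval[of Q b] b(1) by simp
  have "eventually good at_infinity"
    unfolding good_def
    by (intro eventually_conj na nb nR kb kP lP lQ rep evQ eventually_poly_eval_rat_eval
          is_solution_eventually[OF w sol])
  then obtain K where K: "\<And>z. norm z \<ge> K \<Longrightarrow> good z"
    by (auto simp: eventually_at_infinity)
  \<comment> \<open>The threshold 1/4 is used twice: an error below it leaves at least 1/2 of the
    lower bounds for b and P(z,b), and the product of these two halves is 1/4 again.\<close>
  have "eventually (\<lambda>x. x ^ L * exp (C - c * x) < 1 / 4) at_top"
    using c by real_asymp
  then obtain K' where K': "\<And>x. x \<ge> K' \<Longrightarrow> x ^ L * exp (C - c * x) < 1 / 4"
    by (auto simp: eventually_at_top_linorder)
  \<comment> \<open>\<open>K + 1\<close> puts the whole unit disc about z0 into the region where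
    \<open>good\<close> holds; 3 gives |z| >= 2 and |z| <= |z0|^2 on that disc, and absorbs a sum of
    three equal powers.\<close>
  obtain z0 where z0: "norm z0 \<ge> max (max 3 (K + 1)) K'" "c * norm z0 - C \<le> - Re (g z0)"
      "\<And>z. z \<in> cball z0 1 \<Longrightarrow> Re (g z) \<le> 0"
    using deep by blast
  define x where "x = norm z0"
  have x: "x \<ge> 3" "x \<ge> K + 1" "x \<ge> K'" using z0 by (auto simp: x_def)
  define E where "E = exp (Re (g z0))"
  have E0: "E > 0" by (simp add: E_def)
  have "x ^ L * E \<le> x ^ L * exp (C - c * x)"
    using z0(2) x by (intro mult_left_mono) (auto simp: E_def x_def)
  hence xE: "x ^ L * E < 1 / 4"
    using K'[OF x(3)] by linarith
  have small: "x ^ n * E < 1 / 4" if "n \<le> L" for n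
  proof -
    have "x ^ n * E \<le> x ^ L * E"
      using that x E0 by (intro mult_right_mono power_increasing) auto
    thus ?thesis using xE by linarith
  qed
  have near: "norm (w z) \<le> norm z ^ M" "norm z \<le> x\<^sup>2" if z: "z \<in> cball z0 1" for z
  proof -
    have dz: "norm (z0 - z) \<le> 1" using z by (simp add: dist_norm)
    have nz: "x - 1 \<le> norm z" "norm z \<le> x + 1"
      using norm_triangle_ineq2[of z0 z] norm_triangle_ineq2[of z z0] dz
      by (auto simp: x_def norm_minus_commute)
    have "3 * x \<le> x * x" using x by (intro mult_right_mono) auto
    thus "norm z \<le> x\<^sup>2" using nz x unfolding power2_eq_square by linarith
    have gz: "good z" using K[of z] nz x by simp
    have n2: "2 \<le> norm z" using nz x by simp
    have "norm (w z) \<le> norm (rat_eval b z) + norm (rat_eval R z) * exp (Re (g z))"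
      using gz norm_triangle_ineq[of "rat_eval b z" "rat_eval R z * exp (g z)"]
      by (simp add: good_def norm_mult)
    also have "\<dots> \<le> norm z ^ nb + norm z ^ nR * 1"
      using gz z0(3)[OF z] by (intro add_mono mult_mono) (auto simp: good_def)
    also have "\<dots> \<le> norm z ^ (nb + nR) + norm z ^ (nb + nR)"
      using n2 unfolding mult_1_right by (intro add_mono power_increasing) auto
    also have "\<dots> = 2 * norm z ^ (nb + nR)" by simp
    also have "\<dots> \<le> norm z * norm z ^ (nb + nR)"
      using n2 by (intro mult_right_mono) auto
    finally show "norm (w z) \<le> norm z ^ M" by (simp add: M_def)
  qed
  \<comment> \<open>Powers of |z| become powers of \<open>x\<close> by |z| <= x^2, at the price of a
    doubled exponent.\<close>
  have near': "norm (w z) \<le> x ^ (2 * M)" if z: "z \<in> cball z0 1" for z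
  proof -
    have "norm z ^ M \<le> (x\<^sup>2) ^ M"
      using near(2)[OF z] by (intro power_mono) auto
    thus ?thesis using near(1)[OF z] by (simp add: power_mult)
  qed
  have gz0: "good z0" using K[of z0] x by (simp add: x_def)
  define \<beta> where "\<beta> = rat_eval b z0"
  have \<beta>: "norm \<beta> \<le> x ^ nb" "1 \<le> x ^ kb * norm \<beta>"
    using gz0 by (auto simp: good_def \<beta>_def x_def)
  have \<beta>M: "norm \<beta> \<le> norm z0 ^ M"
    using \<beta>(1) power_increasing[of nb M x] x by (auto simp: M_def x_def)
  have wM: "norm (w z0) \<le> norm z0 ^ M" using near(1)[of z0] by simp
  have diff: "norm (w z0 - \<beta>) \<le> x ^ nR * E"
    using gz0 E0 by (auto simp: good_def \<beta>_def E_def x_def norm_mult intro!: mult_right_mono)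
  have wlow: "1 / 2 \<le> x ^ kb * norm (w z0)"
  proof -
    have "1 \<le> x ^ kb * (norm (w z0) + norm (w z0 - \<beta>))"
      using \<beta>(2) norm_triangle_sub[of \<beta> "w z0"] x
      by (intro order_trans[OF \<beta>(2)] mult_left_mono) (auto simp: norm_minus_commute)
    moreover have "x ^ kb * norm (w z0 - \<beta>) \<le> x ^ kb * (x ^ nR * E)"
      using diff x by (intro mult_left_mono) auto
    moreover have "x ^ kb * (x ^ nR * E) < 1 / 4"
      using small[of "kb + nR"] by (simp add: L_def power_add mult_ac)
    ultimately show ?thesis unfolding distrib_left by linarith
  qed
  have Plow: "1 / 2 \<le> x ^ kP * norm (poly_eval P z0 (w z0))"
  proof -
    define p where "p = poly_eval P z0 \<beta>"
    have p1: "1 \<le> x ^ kP * norm p"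
      using gz0 by (auto simp: good_def p_def \<beta>_def x_def)
    have "norm (poly_eval P z0 (w z0) - p) \<le> x ^ lP * norm (w z0 - \<beta>)"
      using gz0 \<beta>M wM unfolding good_def p_def x_def by blast
    also have "\<dots> \<le> x ^ lP * (x ^ nR * E)"
      using diff x by (intro mult_left_mono) auto
    finally have "x ^ kP * norm (poly_eval P z0 (w z0) - p) \<le> x ^ kP * (x ^ lP * (x ^ nR * E))"
      using x by (intro mult_left_mono) auto
    moreover have "x ^ kP * (x ^ lP * (x ^ nR * E)) < 1 / 4"
      using small[of "kP + lP + nR"] by (simp add: L_def power_add mult_ac)
    moreover have "1 \<le> x ^ kP * (norm (poly_eval P z0 (w z0)) + norm (poly_eval P z0 (w z0) - p))"
      using norm_triangle_sub[of p "poly_eval P z0 (w z0)"] x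
      by (intro order_trans[OF p1] mult_left_mono) (auto simp: norm_minus_commute)
    ultimately show ?thesis unfolding distrib_left by linarith
  qed
  have Qup: "norm (poly_eval Q z0 (w z0)) \<le> x ^ (lQ + nR) * E"
  proof -
    have "norm (poly_eval Q z0 (w z0) - poly_eval Q z0 \<beta>) \<le> x ^ lQ * norm (w z0 - \<beta>)"
      using gz0 \<beta>M wM unfolding good_def x_def by blast
    also have "\<dots> \<le> x ^ lQ * (x ^ nR * E)"
      using diff x by (intro mult_left_mono) auto
    finally show ?thesis
      using gz0 by (simp add: good_def \<beta>_def power_add mult_ac)
  qed
  have dw: "norm (deriv w z0) \<le> x ^ (2 * M)"
    by (rule norm_deriv_le_of_norm_le_cball[OF w near'])
  have Sup: "norm (w z0 * (w (z0 + 1) - w (z0 - 1)) + rat_eval a z0 * deriv w z0) \<le> x ^ (4 * M + na + 1)"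
  proof -
    have "norm (w (z0 + 1) - w (z0 - 1)) \<le> x ^ (2 * M) + x ^ (2 * M)"
      using norm_triangle_ineq4[of "w (z0 + 1)" "w (z0 - 1)"] near'[of "z0 + 1"] near'[of "z0 - 1"]
      by (simp add: dist_norm)
    hence "norm (w z0 * (w (z0 + 1) - w (z0 - 1)) + rat_eval a z0 * deriv w z0)
        \<le> x ^ (2 * M) * (x ^ (2 * M) + x ^ (2 * M)) + x ^ na * x ^ (2 * M)"
      using near'[of z0] dw gz0 x
      by (intro order_trans[OF norm_triangle_ineq] add_mono) (auto simp: norm_mult good_def x_def intro!: mult_mono)
    also have "\<dots> = x ^ (4 * M) + x ^ (4 * M) + x ^ (2 * M + na)"
      by (simp add: distrib_left power_add[symmetric] add.commute)
    also have "\<dots> \<le> x ^ (4 * M + na) + x ^ (4 * M + na) + x ^ (4 * M + na)"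
      using x by (intro add_mono power_increasing) auto
    also have "\<dots> = 3 * x ^ (4 * M + na)" by simp
    also have "\<dots> \<le> x * x ^ (4 * M + na)"
      using x by (intro mult_right_mono) auto
    finally show ?thesis by simp
  qed
  have "1 / 2 * (1 / 2) \<le> (x ^ kb * norm (w z0)) * (x ^ kP * norm (poly_eval P z0 (w z0)))"
    using wlow Plow by (intro mult_mono) auto
  also have "\<dots> = x ^ (kb + kP) * norm (w z0 * poly_eval P z0 (w z0))"
    by (simp add: norm_mult power_add mult_ac)
  also have "w z0 * poly_eval P z0 (w z0) =
      poly_eval Q z0 (w z0) * (w z0 * (w (z0 + 1) - w (z0 - 1)) + rat_eval a z0 * deriv w z0)"
    using gz0 unfolding good_def by metis
  also have "x ^ (kb + kP) * norm \<dots> \<le> x ^ (kb + kP) * ((x ^ (lQ + nR) * E) * x ^ (4 * M + na + 1))"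
    unfolding norm_mult[of "poly_eval Q z0 (w z0)"]
    using Qup Sup x E0 by (intro mult_left_mono mult_mono) auto
  also have "\<dots> = x ^ (kb + kP + (lQ + nR) + (4 * M + na + 1)) * E"
    by (simp only: power_add mult_ac)
  also have "\<dots> < 1 / 4"
    by (rule small) (simp add: L_def)
  finally show False by simp
qed

theorem corollary1p1:
  fixes a :: ratfun and P Q :: "ratfun poly"
  assumes deg_Q: "Polynomial.degree Q \<ge> 1"
    and roots_Q: "\<And>x :: ratfun alg_closure. poly (map_poly to_ac Q) x = 0 \<Longrightarrow>
       \<exists>b :: ratfun. x = to_ac b \<and> b \<noteq> 0 \<and> poly P b \<noteq> 0"
  shows "\<not> (\<exists>w. w holomorphic_on UNIV \<and> transcendental w \<and> hyper_order w < 1 \<and>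
            is_solution a P Q w)"
proof
  assume "\<exists>w. w holomorphic_on UNIV \<and> transcendental w \<and> hyper_order w < 1 \<and> is_solution a P Q w"
  then obtain w where w: "w holomorphic_on UNIV" and trans: "transcendental w"
    and ho: "hyper_order w < 1" and sol: "is_solution a P Q w" by blast
  \<comment> \<open>The embedding preserves the degree, so Q has a root in the algebraic closure,
    and \<open>roots_Q\<close> places it in the field of rational functions.\<close>
  have "Polynomial.degree (map_poly to_ac Q) = Polynomial.degree Q"
    by (rule degree_map_poly) simp
  then obtain x where x: "poly (map_poly to_ac Q) x = 0"
    using alg_closed_imp_poly_has_root[of "map_poly to_ac Q"] deg_Q by auto
  then obtain b where b: "x = to_ac b" "b \<noteq> 0" "poly P b \<noteq> 0"
    using roots_Q by blast
  have Qb: "poly Q b = 0"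
    using x b(1) by (simp add: poly_map_poly_to_ac)

  define B1 where "B1 = fst (quot_of_fract b)"
  define B2 where "B2 = snd (quot_of_fract b)"
  have B2: "B2 \<noteq> 0" by (simp add: B2_def)
  have bB: "rat_eval b z = poly B1 z / poly B2 z" for z
    by (simp add: rat_eval_def B1_def B2_def)
  \<comment> \<open>Clearing the denominator of b makes w - b entire; far out the zeros of
    \<open>F\<close> are exactly the points with w = b.\<close>
  define F where "F = (\<lambda>z. poly B2 z * w z - poly B1 z)"
  have F: "F holomorphic_on UNIV"
    unfolding F_def by (intro holomorphic_intros w)
  have "eventually (\<lambda>z. F z \<noteq> 0) at_infinity"
  proof -
    obtain kb where kb: "eventually (\<lambda>z. 1 \<le> norm z ^ kb * norm (rat_eval b z)) at_infinity"
      using eventually_rat_eval_ge_power[OF b(2)] by blast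
    obtain kP where kP: "eventually (\<lambda>z. 1 \<le> norm z ^ kP * norm (rat_eval (poly P b) z)) at_infinity"
      using eventually_rat_eval_ge_power[OF b(3)] by blast
    from kb kP is_solution_eventually[OF w sol] eventually_poly_eval_rat_eval[of P b]
      eventually_poly_eval_rat_eval[of Q b] eventually_poly_neq_0_at_infinity[OF B2]
    show ?thesis
    proof eventually_elim
      case (elim z)
      show ?case
      proof
        assume "F z = 0"
        hence "w z = rat_eval b z"
          using elim(6) by (simp add: F_def bB field_simps)
        hence "rat_eval b z * rat_eval (poly P b) z = 0"
          using elim(3,4,5) Qb by simp
        thus False using elim(1,2) by auto
      qed
    qed
  qed
  from finite_zeros_entire[OF F this] obtain p g
    where p: "p \<noteq> 0" and g: "g holomorphic_on UNIV" and Fpg: "\<And>z. F z = poly p z * exp (g z)"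
    using entire_finite_zeros_factorization[OF F] by blast
  obtain \<zeta> where \<zeta>: "deriv g \<zeta> \<noteq> 0"
    using transcendental_exponent_nonconst[OF trans B2 g] Fpg unfolding F_def by blast

  define R where "R = Fract p B2"
  have R0: "R \<noteq> 0" using p B2 by (simp add: R_def Zero_fract_def eq_fract)
  have rep: "eventually (\<lambda>z. w z = rat_eval b z + rat_eval R z * exp (g z)) at_infinity"
    using eventually_poly_neq_0_at_infinity[OF B2]
  proof eventually_elim
    case (elim z)
    have "poly B2 z * w z = poly B1 z + poly p z * exp (g z)"
      using Fpg[of z] by (simp add: F_def algebra_simps)
    thus ?case
      using elim by (simp add: bB R_def rat_eval_Fract[OF B2] field_simps)
  qed

  obtain nb where nb: "eventually (\<lambda>z. norm (rat_eval b z) \<le> norm z ^ nb) at_infinity"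
    using eventually_rat_eval_le_power by blast
  obtain kR where kR: "eventually (\<lambda>z. 1 \<le> norm z ^ kR * norm (rat_eval R z)) at_infinity"
    using eventually_rat_eval_ge_power[OF R0] by blast
  \<comment> \<open>Solve the representation for exp g = (w - b) / R; the lower bound for R makes
    the division harmless. This is how the growth of w reaches g.\<close>
  have bound: "eventually (\<lambda>z. norm (exp (g z)) \<le> norm z ^ (kR + nb) * (1 + norm (w z))) at_infinity"
    using rep nb kR eventually_norm_ge_at_infinity[of 1]
  proof eventually_elim
    case (elim z)
    have x1: "1 \<le> norm z ^ nb"
      using elim(4) by (rule one_le_power)
    have "norm (exp (g z)) = 1 * norm (exp (g z))" by simp
    also have "\<dots> \<le> (norm z ^ kR * norm (rat_eval R z)) * norm (exp (g z))"
      using elim(3) by (rule mult_right_mono) simp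
    also have "\<dots> = norm z ^ kR * norm (w z - rat_eval b z)"
      using elim(1) by (simp only: add_diff_cancel_left' norm_mult mult.assoc)
    also have "norm (w z - rat_eval b z) \<le> norm z ^ nb * norm (w z) + norm z ^ nb * 1"
      using norm_triangle_ineq4[of "w z" "rat_eval b z"] elim(2)
        mult_right_mono[OF x1 norm_ge_zero[of "w z"]] by linarith
    also have "norm z ^ kR * (norm z ^ nb * norm (w z) + norm z ^ nb * 1)
        = norm z ^ (kR + nb) * (1 + norm (w z))"
      by (simp add: power_add algebra_simps)
    finally show ?case by (simp add: mult_left_mono)
  qed

  obtain c C where cC: "c > 0" "\<And>K. \<exists>z0. norm z0 \<ge> K \<and> c * norm z0 - C \<le> - Re (g z0)
      \<and> (\<forall>z\<in>cball z0 1. Re (g z) \<le> 0)"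
    using exists_deep_disc[OF g \<zeta> subexponential_growth_of_logarithm[OF g w ho bound]] by blast
  show False
    by (rule no_solution_near_root[OF w sol Qb b(2,3) rep cC])
qed

end
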